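(* Let $S_{12}$ and $S_{20}$ be the sizes of the open cluster of a uniformly random vertex in bond percolation with parameter $p$ on the graph of the dodecahedron and on the graph of the icosahedron, respectively. For all $p\in(0,1)$, $$\begin{aligned} E(S_{12}) \geq{}& 1 + 3p + 6p^2 + 12p^3 + 24p^4 + 30p^5 - 24p^6 - 30p^7 - 36p^8 + 3p^9 - 6p^{10} + 42p^{11} \\ & - 6p^{12} + 18p^{13} - 21p^{14} + 14p^{15} - 6p^{17} - 9p^{18} + 6p^{21} - p^{24} \end{aligned}$$ and $$\begin{aligned} E(S_{20}) \geq{}& 1 + 5p + 20p^2 + 60p^3 - 90p^4 - 75p^5 + 190p^7 - 10p^8 - 80p^9 - 60p^{10} + 10p^{11} \\ & - 5p^{12} + 120p^{13} - 35p^{14} - 88p^{15} + 35p^{16} + 40p^{17} - 35p^{18} + 10p^{19} - p^{20}. \end{aligned}$$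
   Context: Bond percolation with parameter $p$ on a finite simple undirected graph $\mathscr{G}=(\mathscr{V},\mathscr{E})$: $(\zeta(e))_{e\in\mathscr{E}}$ are independent Bernoulli($p$) random variables; edge $e$ is open if $\zeta(e)=1$ and closed if $\zeta(e)=0$. For a vertex $x$, the open cluster $\mathscr{C}_x$ is the set of vertices $y\in\mathscr{V}$ such that there is a path of open edges connecting $x$ and $y$ (in particular $x\in\mathscr{C}_x$). The vertex $x$ is chosen uniformly at random in $\mathscr{V}$, independently of the $\zeta(e)$, and the cluster size is $\mathrm{card}(\mathscr{C}_x)$. The graph of the dodecahedron consists of the 20 vertices and 30 edges of the regular dodecahedron (12 faces; equivalently the generalized Petersen graph $GP(10,2)$). The graph of the icosahedron consists of the 12 vertices and 30 edges of the regular icosahedron (20 faces; equivalently, the vertices are the cyclic permutations of $(0,\pm 1,\pm\varphi)$ with $\varphi=(1+\sqrt5)/2$, two being adjacent when at Euclidean distance 2). *)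

theory Defs
  imports "HOL-Probability.Probability"
begin

text \<open>
  A finite simple undirected graph is given by its vertex set and its edge set, an edge being the
  two-element set of its end points.
\<close>

text \<open>Only the values \<open>z e\<close> with \<open>e \<in> E\<close> matter; \<open>z e = True\<close> means that \<open>e\<close> is open.\<close>

definition open_step :: "'a set set \<Rightarrow> ('a set \<Rightarrow> bool) \<Rightarrow> ('a \<times> 'a) set" where
  "open_step E z = {(u, v). {u, v} \<in> E \<and> z {u, v}}"

definition open_cluster :: "'a set \<Rightarrow> 'a set set \<Rightarrow> ('a set \<Rightarrow> bool) \<Rightarrow> 'a \<Rightarrow> 'a set" where
  "open_cluster V E z x = {y \<in> V. (x, y) \<in> (open_step E z)\<^sup>*}"

text \<open>
  The joint law of a uniformly random vertex and of an independent family of Bernoulli(\<open>p\<close>)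
  edge states. The value \<open>False\<close> is only the default taken by the states outside \<open>E\<close>.
\<close>

definition bond_percolation ::
    "'a set \<Rightarrow> 'a set set \<Rightarrow> real \<Rightarrow> ('a \<times> ('a set \<Rightarrow> bool)) pmf" where
  "bond_percolation V E p =
     pair_pmf (pmf_of_set V) (Pi_pmf E False (\<lambda>_. bernoulli_pmf p))"

definition expected_cluster_size :: "'a set \<Rightarrow> 'a set set \<Rightarrow> real \<Rightarrow> real" where
  "expected_cluster_size V E p =
     measure_pmf.expectation (bond_percolation V E p)
       (\<lambda>(x, z). real (card (open_cluster V E z x)))"

datatype petersen_vertex = Outer nat | Inner nat

definition petersen_vertices :: "nat \<Rightarrow> petersen_vertex set" where
  "petersen_vertices n = Outer ` {..<n} \<union> Inner ` {..<n}"

definition petersen_edges :: "nat \<Rightarrow> nat \<Rightarrow> petersen_vertex set set" where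
  "petersen_edges n k =
     (\<Union>i<n. {{Outer i, Outer ((i + 1) mod n)}, {Outer i, Inner i},
              {Inner i, Inner ((i + k) mod n)}})"

text \<open>The graph of the regular dodecahedron is the generalized Petersen graph \<open>GP(10,2)\<close>.\<close>

definition dodecahedron_vertices :: "petersen_vertex set" where
  "dodecahedron_vertices = petersen_vertices 10"

definition dodecahedron_edges :: "petersen_vertex set set" where
  "dodecahedron_edges = petersen_edges 10 2"

definition golden_ratio :: real where
  "golden_ratio = (1 + sqrt 5) / 2"

text \<open>The cyclic permutations of \<open>(0, \<plusminus>1, \<plusminus>\<phi>)\<close>, with \<open>\<phi>\<close> the golden ratio.\<close>

definition icosahedron_vertices :: "(real \<times> real \<times> real) set" where
  "icosahedron_vertices =
     (\<Union>s\<in>{-1, 1}. \<Union>t\<in>{-golden_ratio, golden_ratio}. {(0, s, t), (t, 0, s), (s, t, 0)})"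

text \<open>On the product type, \<open>dist\<close> is the Euclidean distance; 2 is the edge length of the solid.\<close>

definition icosahedron_edges :: "(real \<times> real \<times> real) set set" where
  "icosahedron_edges =
     {{u, v} | u v. u \<in> icosahedron_vertices \<and> v \<in> icosahedron_vertices \<and> dist u v = 2}"

end

theory Submission
  imports Defs
begin

text \<open>
  The expected cluster size is the sum of the connection probabilities \<open>P(x \<leftrightarrow> y)\<close> over all ordered
  pairs of vertices, divided by the number of vertices. Each of them is bounded from below by the
  probability that some \<^emph>\<open>short\<close> self-avoiding path from \<open>x\<close> to \<open>y\<close> is open. Paths of at most five
  edges in the dodecahedron and of at most three edges in the icosahedron, the diameters of these
  graphs, give exactly the two polynomials of the theorem.

  The probability that one of several sets of edges is entirely open is a polynomial in \<open>p\<close>, obtained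
  by removing one set \<open>c\<close> at a time: \<open>P(c \<union> D) = P(D) + p\<^bsup>card c\<^esup> (1 - P(D'))\<close>, where \<open>D'\<close> consists
  of the sets of \<open>D\<close> without their edges in \<open>c\<close>, because the states on and off \<open>c\<close> are independent
  (\<open>prob_some_all_open\<close>). At most ten short paths join two given vertices, so that this recursion can
  be carried out inside the logic.

  Both graphs are vertex transitive, hence the paths from a single vertex suffice. The computation
  takes place in a copy of the graph with vertices \<open>0, \<dots>, n - 1\<close>, given by its adjacency lists; every
  edge-preserving bijection from this copy to the graph transports the bound from the vertex 0 to its image, and
  composing one such bijection with the automorphisms of the copy reaches all vertices
  (\<open>expected_cluster_size_ge\<close>).
\<close>

section \<open>The probability that one of several edge sets is open\<close>

abbreviation bond_states :: "'e set \<Rightarrow> real \<Rightarrow> ('e \<Rightarrow> bool) pmf" where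
  "bond_states E p \<equiv> Pi_pmf E False (\<lambda>_. bernoulli_pmf p)"

text \<open>
  The two sets may be uncountable: the measures live on the countable supports.
\<close>

lemma prob_pair_pmf_times:
  "measure_pmf.prob (pair_pmf M N) (A \<times> B) = measure_pmf.prob M A * measure_pmf.prob N B"
proof -
  have "measure_pmf.prob (pair_pmf M N) (A \<times> B)
      = measure_pmf.prob (pair_pmf M N) ((A \<inter> set_pmf M) \<times> (B \<inter> set_pmf N))"
    by (subst measure_Int_set_pmf[symmetric]) (simp add: Times_Int_Times)
  also have "\<dots> = measure_pmf.prob M (A \<inter> set_pmf M) * measure_pmf.prob N (B \<inter> set_pmf N)"
    by (intro measure_pmf_prob_product countable_Int2 countable_set_pmf)
  finally show ?thesis
    by (simp add: measure_Int_set_pmf)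
qed

text \<open>
  Splitting the product measure into the factors inside and outside \<open>C\<close> makes the two events
  independent, and the probability of the second one is the same in both measures.
\<close>

lemma prob_all_open_and:
  assumes "finite E" "C \<subseteq> E" "0 \<le> p" "p \<le> 1"
    and Q: "\<And>z z'. \<forall>e. e \<notin> C \<longrightarrow> z e = z' e \<Longrightarrow> Q z = Q z'"
  shows "measure_pmf.prob (bond_states E p) {z. (\<forall>e\<in>C. z e) \<and> Q z}
    = p ^ card C * measure_pmf.prob (bond_states E p) {z. Q z}"
proof -
  let ?glue = "\<lambda>(f, g) x. if x \<in> C then f x else g x"
  have "finite C"
    using assms finite_subset by blast
  have split: "bond_states E p
      = map_pmf ?glue (pair_pmf (bond_states C p) (bond_states (E - C) p))"
    using Pi_pmf_union[of C "E - C" False "\<lambda>_. bernoulli_pmf p"] \<open>finite C\<close> assms(1,2)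
    by (simp add: Un_absorb1)
  \<comment> \<open>\<open>Q\<close> looks only at the second component, \<open>C\<close> being open only at the first one.\<close>
  have glue: "Q (?glue q) = Q (snd q)" for q
    by (rule Q) (simp add: case_prod_beta)
  have glue_open: "(\<forall>e\<in>C. ?glue q e) \<longleftrightarrow> fst q \<in> Pi C (\<lambda>_. {True})" for q
    by (auto simp: case_prod_beta Pi_def)
  have 1: "?glue -` {z. (\<forall>e\<in>C. z e) \<and> Q z} = Pi C (\<lambda>_. {True}) \<times> {g. Q g}"
    by (rule set_eqI) (simp only: vimage_eq mem_Collect_eq glue glue_open mem_Times_iff)
  have 2: "?glue -` {z. Q z} = UNIV \<times> {g. Q g}"
    by (rule set_eqI) (simp only: vimage_eq mem_Collect_eq glue mem_Times_iff UNIV_I simp_thms)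
  have "measure_pmf.prob (bond_states C p) (Pi C (\<lambda>_. {True})) = p ^ card C"
    using assms \<open>finite C\<close> by (simp add: measure_Pi_pmf_Pi measure_pmf_single)
  then show ?thesis
    unfolding split measure_map_pmf 1 2 prob_pair_pmf_times by simp
qed

text \<open>
  Inclusion-exclusion organized as a recursion. Removing the edges of \<open>c\<close> from the remaining sets
  expresses that these edges are known to be open. The value 1 for an empty set of edges is what the
  general formula would give, but it cuts off the recursion.
\<close>

fun union_poly :: "'e list list \<Rightarrow> real poly" where
  "union_poly [] = 0"
| "union_poly (c # D) = (if c = [] then 1 else
     union_poly D + monom 1 (card (set c)) * (1 - union_poly (map (filter (\<lambda>e. e \<notin> set c)) D)))"

text \<open>
  The edges are named by \<open>\<phi>\<close>, so that the polynomial can be computed from names while the states are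
  those of the edges themselves. By inclusion-exclusion the new set contributes
  \<open>P(A) - P(A \<inter> B)\<close>; on \<open>A\<close>, where all edges of \<open>c\<close> are open, \<open>B\<close> may be replaced by
  the event for the reduced sets, which is independent of \<open>A\<close>.
\<close>

lemma prob_some_all_open:
  assumes "finite E" "0 \<le> p" "p \<le> 1" "inj_on \<phi> L" "\<phi> ` L \<subseteq> E"
  shows "(\<Union>c\<in>set D. set c) \<subseteq> L \<Longrightarrow>
    measure_pmf.prob (bond_states E p) {z. \<exists>c\<in>set D. \<forall>e\<in>set c. z (\<phi> e)} = poly (union_poly D) p"
proof (induction D rule: union_poly.induct)
  case 1
  then show ?case by simp
next
  case (2 c D)
  show ?case
  proof (cases "c = []")
    case True
    then show ?thesis by simp
  next
    case False
    let ?P = "\<lambda>A. measure_pmf.prob (bond_states E p) A"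
    let ?D' = "map (filter (\<lambda>e. e \<notin> set c)) D"
    let ?C = "\<phi> ` set c"
    let ?A = "{z. \<forall>e\<in>?C. z e}"
    let ?B = "\<lambda>D. {z. \<exists>d\<in>set D. \<forall>e\<in>set d. z (\<phi> e)}"
    have inj: "inj_on \<phi> (set c)"
      using 2 assms(4) inj_on_subset by (metis Sup_upper UN_subset_iff list.set_intros(1))
    have card: "card ?C = card (set c)"
      using inj by (rule card_image)
    have sub: "?C \<subseteq> E"
      using 2 assms(5) by auto
    have off: "\<phi> e \<notin> ?C" if "d \<in> set D" "e \<in> set d" "e \<notin> set c" for d e
    proof
      assume "\<phi> e \<in> ?C"
      then obtain e' where e': "e' \<in> set c" "\<phi> e = \<phi> e'"
        by blast
      moreover have "e \<in> L" "e' \<in> L"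
        using that e' 2(3) by auto
      ultimately show False
        using inj_onD[OF assms(4)] that(3) by blast
    qed
    have A: "?P ?A = p ^ card (set c)"
      using prob_all_open_and[OF assms(1) sub assms(2,3), of "\<lambda>_. True"] by (simp add: card)
    have "?P (?A \<inter> ?B ?D') = p ^ card (set c) * ?P (?B ?D')"
    proof -
      have local: "(z \<in> ?B ?D') = (z' \<in> ?B ?D')" if "\<forall>e. e \<notin> ?C \<longrightarrow> z e = z' e" for z z'
        using that off by (auto 0 4)
      have "?A \<inter> ?B ?D' = {z. (\<forall>e\<in>?C. z e) \<and> z \<in> ?B ?D'}"
        by blast
      then show ?thesis
        using prob_all_open_and[OF assms(1) sub assms(2,3), of "\<lambda>z. z \<in> ?B ?D'", OF local]
        by (simp only: card Collect_mem_eq)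
    qed
    moreover have "?A \<inter> ?B D = ?A \<inter> ?B ?D'"
      by fastforce
    moreover have "?B (c # D) = ?B D \<union> ?A"
      by auto
    ultimately have "?P (?B (c # D)) = ?P (?B D) + (?P ?A - p ^ card (set c) * ?P (?B ?D'))"
      by (simp add: measure_pmf.finite_measure_Union' measure_pmf.finite_measure_Diff')
    moreover have "?P (?B D) = poly (union_poly D) p"
      using False 2(3) by (intro "2.IH"(1)) auto
    moreover have "?P (?B ?D') = poly (union_poly ?D') p"
      using False 2(3) by (intro "2.IH"(2)) auto
    ultimately show ?thesis
      using False A by (simp add: poly_monom algebra_simps)
  qed
qed

section \<open>Cluster size and short open paths\<close>

lemma expected_cluster_size_eq:
  assumes "finite V" "V \<noteq> {}" "finite E"
  shows "expected_cluster_size V E p =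
    (\<Sum>x\<in>V. \<Sum>y\<in>V. measure_pmf.prob (bond_states E p) {z. (x, y) \<in> (open_step E z)\<^sup>*}) / card V"
proof -
  define S where "S = set_pmf (bond_states E p)"
  have "finite S"
    using assms(3) by (auto simp: S_def set_Pi_pmf intro!: finite_PiE_dflt)
  have size: "real (card (open_cluster V E z x)) = (\<Sum>y\<in>V. of_bool ((x, y) \<in> (open_step E z)\<^sup>*))"
    for z x
    using assms(1) by (simp add: open_cluster_def Int_def)
  have prob: "measure_pmf.prob (bond_states E p) {z. R z}
      = (\<Sum>z\<in>S. of_bool (R z) * pmf (bond_states E p) z)" for R
  proof -
    have "measure_pmf.prob (bond_states E p) {z. R z}
        = measure_pmf.expectation (bond_states E p) (\<lambda>z. indicator {z. R z} z)"
      by simp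
    also have "\<dots> = (\<Sum>z\<in>S. indicator {z. R z} z * pmf (bond_states E p) z)"
      by (rule integral_measure_pmf_real) (use \<open>finite S\<close> in \<open>auto simp: S_def\<close>)
    finally show ?thesis
      by (simp add: indicator_def of_bool_def)
  qed
  have "expected_cluster_size V E p
      = (\<Sum>(x, z)\<in>V \<times> S. real (card (open_cluster V E z x)) * (pmf (bond_states E p) z / card V))"
    unfolding expected_cluster_size_def bond_percolation_def
    by (subst integral_measure_pmf_real[of "V \<times> S"])
      (use assms \<open>finite S\<close> in \<open>auto simp: S_def pmf_pair pmf_of_set[OF assms(2,1)] intro!: sum.cong\<close>)
  also have "\<dots> = (\<Sum>x\<in>V. \<Sum>z\<in>S. \<Sum>y\<in>V.
      of_bool ((x, y) \<in> (open_step E z)\<^sup>*) * pmf (bond_states E p) z) / card V"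
    by (simp only: sum.cartesian_product[symmetric] size sum_distrib_right sum_divide_distrib
        times_divide_eq_right)
  also have "\<dots> = (\<Sum>x\<in>V. \<Sum>y\<in>V. \<Sum>z\<in>S.
      of_bool ((x, y) \<in> (open_step E z)\<^sup>*) * pmf (bond_states E p) z) / card V"
    by (subst sum.swap) simp
  finally show ?thesis
    by (simp only: prob)
qed

text \<open>
  The edge sets of the self-avoiding paths from \<open>s\<close> to \<open>t\<close> with at most \<open>k\<close> edges that also avoid the
  vertices \<open>vis\<close>. An edge is named by its end points in increasing order, so that both directions of
  traversal use the same name.
\<close>

fun path_edges :: "nat list list \<Rightarrow> nat \<Rightarrow> nat list \<Rightarrow> nat \<Rightarrow> nat \<Rightarrow> (nat \<times> nat) list list" where
  "path_edges adj 0 vis s t = (if s = t then [[]] else [])"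
| "path_edges adj (Suc k) vis s t = (if s = t then [[]] else
     concat (map (\<lambda>v. map ((#) (min s v, max s v)) (path_edges adj k (s # vis) v t))
       (filter (\<lambda>v. v \<notin> set vis) (adj ! s))))"

text \<open>
  For lower bounds it is enough that edges go to edges: additional ones can only enlarge the clusters.
\<close>

definition embedding :: "nat list list \<Rightarrow> 'a set \<Rightarrow> 'a set set \<Rightarrow> (nat \<Rightarrow> 'a) \<Rightarrow> bool" where
  "embedding adj V E f \<longleftrightarrow> bij_betw f {..<length adj} V \<and>
     (\<forall>u<length adj. \<forall>v\<in>set (adj ! u). v < length adj \<and> {f u, f v} \<in> E)"

lemma path_edges_subset:
  assumes "embedding adj V E f"
  shows "s < length adj \<Longrightarrow> c \<in> set (path_edges adj k vis s t) \<Longrightarrow>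
    set c \<subseteq> {(u, v). u \<le> v \<and> v < length adj \<and> {f u, f v} \<in> E}"
proof (induction k arbitrary: vis s c)
  case (Suc k)
  show ?case
  proof (cases "s = t")
    case False
    then obtain v c' where v: "v \<in> set (adj ! s)" "c = (min s v, max s v) # c'"
      "c' \<in> set (path_edges adj k (s # vis) v t)"
      using Suc.prems by auto
    then have "v < length adj" "{f s, f v} \<in> E"
      using assms Suc.prems by (auto simp: embedding_def)
    then show ?thesis
      using Suc.IH[OF _ v(3)] Suc.prems(1) v(2) by (auto simp: min_def max_def insert_commute)
  qed (use Suc in auto)
qed (auto split: if_splits)

lemma path_edges_connected:
  assumes "embedding adj V E f"
  shows "s < length adj \<Longrightarrow> c \<in> set (path_edges adj k vis s t) \<Longrightarrow>
    \<forall>(u, v)\<in>set c. z {f u, f v} \<Longrightarrow> (f s, f t) \<in> (open_step E z)\<^sup>*"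
proof (induction k arbitrary: vis s c)
  case (Suc k)
  show ?case
  proof (cases "s = t")
    case False
    then obtain v c' where v: "v \<in> set (adj ! s)" "c = (min s v, max s v) # c'"
      "c' \<in> set (path_edges adj k (s # vis) v t)"
      using Suc.prems by auto
    then have "v < length adj" "{f s, f v} \<in> E"
      using assms Suc.prems by (auto simp: embedding_def)
    moreover have "z {f s, f v}"
      using Suc.prems(3) v(2) by (auto simp: min_def max_def insert_commute split: if_splits)
    ultimately have "(f s, f v) \<in> open_step E z"
      by (simp add: open_step_def)
    also have "(f v, f t) \<in> (open_step E z)\<^sup>*"
      using Suc.IH[OF \<open>v < length adj\<close> v(3)] Suc.prems(3) v(2) by auto
    finally show ?thesis .
  qed simp
qed (auto split: if_splits)

text \<open>
  Increasing pairs of numbers name edges of the graph without repetition, \<open>f\<close> being injective; so the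
  polynomial of the named paths is the probability that their images contain an open path.
\<close>

lemma two_point_ge:
  assumes "embedding adj V E f" "finite E" "0 \<le> p" "p \<le> 1" "s < length adj"
  shows "poly (union_poly (path_edges adj k [] s t)) p
    \<le> measure_pmf.prob (bond_states E p) {z. (f s, f t) \<in> (open_step E z)\<^sup>*}"
proof -
  let ?\<phi> = "\<lambda>(u, v). {f u, f v}"
  let ?L = "{(u, v). u \<le> v \<and> v < length adj \<and> {f u, f v} \<in> E}"
  have f: "inj_on f {..<length adj}"
    using assms(1) by (simp add: embedding_def bij_betw_def)
  have "inj_on ?\<phi> ?L"
  proof (rule inj_onI, clarify)
    fix u v u' v' assume *: "u \<le> v" "v < length adj" "u' \<le> v'" "v' < length adj"
      "{f u, f v} = {f u', f v'}"
    have "u = u' \<and> v = v' \<or> u = v' \<and> v = u'"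
      using *(1-4) *(5)[unfolded doubleton_eq_iff] inj_onD[OF f] by fastforce
    then show "u = u' \<and> v = v'"
      using * by auto
  qed
  then have "poly (union_poly (path_edges adj k [] s t)) p = measure_pmf.prob (bond_states E p)
      {z. \<exists>c\<in>set (path_edges adj k [] s t). \<forall>e\<in>set c. z (?\<phi> e)}"
    using path_edges_subset[OF assms(1,5)] assms(2-4)
    by (intro prob_some_all_open[symmetric, where L = ?L]) (auto simp: subset_iff)
  also have "\<dots> \<le> measure_pmf.prob (bond_states E p) {z. (f s, f t) \<in> (open_step E z)\<^sup>*}"
    using path_edges_connected[OF assms(1,5)]
    by (intro measure_pmf.finite_measure_mono) (auto simp: case_prod_beta)
  finally show ?thesis .
qed

section \<open>Vertex transitivity\<close>

definition automorphism :: "nat list list \<Rightarrow> nat list \<Rightarrow> bool" where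
  "automorphism adj g \<longleftrightarrow> length g = length adj \<and> distinct g \<and>
     (\<forall>u\<in>set [0..<length adj]. g ! u < length adj \<and>
        (\<forall>v\<in>set (adj ! u). g ! v \<in> set (adj ! (g ! u))))"

lemma embedding_automorphism:
  assumes "embedding adj V E f" "automorphism adj g"
  shows "embedding adj V E (\<lambda>u. f (g ! u))"
proof -
  let ?n = "length adj"
  have g: "g ! u < ?n" if "u < ?n" for u
    using assms(2) that by (auto simp: automorphism_def)
  have "inj_on ((!) g) {..<?n}"
    using assms(2) by (auto simp: automorphism_def inj_on_def nth_eq_iff_index_eq)
  then have "bij_betw ((!) g) {..<?n} {..<?n}"
    using g endo_inj_surj[of "{..<?n}" "(!) g"] by (auto simp: bij_betw_def)
  then have "bij_betw (f \<circ> (!) g) {..<?n} V"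
    using assms(1) by (auto simp: embedding_def intro: bij_betw_trans)
  then show ?thesis
    using assms g by (auto simp: embedding_def automorphism_def comp_def)
qed

text \<open>
  A word of automorphisms acts from right to left. Composing the embedding with it moves the base
  point 0 to any prescribed vertex in the orbit of 0.
\<close>

lemma embedding_at_image:
  assumes "embedding adj V E f" "\<forall>g\<in>set w. automorphism adj g"
  shows "\<exists>f'. embedding adj V E f' \<and> f' 0 = f (foldr (!) w 0)"
  using assms
proof (induction w arbitrary: f)
  case (Cons g w)
  then show ?case
    using Cons.IH[OF embedding_automorphism[OF Cons.prems(1)]] by simp
qed auto

text \<open>
  For every vertex \<open>x\<close> some embedding takes 0 to \<open>x\<close>, and it carries the sum over the targets \<open>t\<close> to the
  sum over all vertices. The same bound thus holds for every starting vertex, hence for the average.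
\<close>

theorem expected_cluster_size_ge:
  assumes f: "embedding adj V E f" and "finite E" "0 \<le> p" "p \<le> 1" "adj \<noteq> []"
    and W: "\<forall>w\<in>set W. \<forall>g\<in>set w. automorphism adj g"
      "{..<length adj} \<subseteq> set (map (\<lambda>w. foldr (!) w 0) W)"
  shows "(\<Sum>t<length adj. poly (union_poly (path_edges adj k [] 0 t)) p)
    \<le> expected_cluster_size V E p"
proof -
  let ?P = "\<lambda>x y. measure_pmf.prob (bond_states E p) {z. (x, y) \<in> (open_step E z)\<^sup>*}"
  let ?S = "\<Sum>t<length adj. poly (union_poly (path_edges adj k [] 0 t)) p"
  have bij: "bij_betw f {..<length adj} V"
    using f by (simp add: embedding_def)
  have V: "finite V" "V \<noteq> {}"
    using bij_betw_finite[OF bij] bij_betw_same_card[OF bij] \<open>adj \<noteq> []\<close> by auto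
  have "?S \<le> (\<Sum>y\<in>V. ?P x y)" if "x \<in> V" for x
  proof -
    have "x \<in> f ` {..<length adj}"
      using bij that by (simp add: bij_betw_def)
    then obtain w where "w \<in> set W" "x = f (foldr (!) w 0)"
      using W(2) by auto
    then obtain f' where f': "embedding adj V E f'" "f' 0 = x"
      using embedding_at_image[OF f] W(1) by metis
    have "?S \<le> (\<Sum>t<length adj. ?P (f' 0) (f' t))"
      using assms(2-5) by (intro sum_mono two_point_ge[OF f'(1)]) auto
    also have "\<dots> = (\<Sum>y\<in>V. ?P x y)"
      unfolding f'(2) using f'(1) by (intro sum.reindex_bij_betw) (simp add: embedding_def)
    finally show ?thesis .
  qed
  then have "card V * ?S \<le> (\<Sum>x\<in>V. \<Sum>y\<in>V. ?P x y)"
    using sum_bounded_below[of V ?S] by simp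
  then show ?thesis
    using V by (simp add: expected_cluster_size_eq assms(2) card_gt_0_iff pos_le_divide_eq mult.commute)
qed

section \<open>The dodecahedron\<close>

text \<open>
  The number \<open>i < 10\<close> stands for \<open>Outer i\<close> and \<open>10 + i\<close> for \<open>Inner i\<close>.
\<close>

definition dodecahedron_adj :: "nat list list" where
  "dodecahedron_adj =
    [[1, 9, 10], [0, 2, 11], [1, 3, 12], [2, 4, 13], [3, 5, 14],
     [4, 6, 15], [5, 7, 16], [6, 8, 17], [7, 9, 18], [0, 8, 19],
     [0, 12, 18], [1, 13, 19], [2, 10, 14], [3, 11, 15], [4, 12, 16],
     [5, 13, 17], [6, 14, 18], [7, 15, 19], [8, 10, 16], [9, 11, 17]]"

lemma length_dodecahedron_adj: "length dodecahedron_adj = 20"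
  by (simp add: dodecahedron_adj_def)

definition dodecahedron_vertex :: "nat \<Rightarrow> petersen_vertex" where
  "dodecahedron_vertex i = (if i < 10 then Outer i else Inner (i - 10))"

definition dodecahedron_rotation :: "nat list" where
  "dodecahedron_rotation =
    [1, 2, 3, 4, 5, 6, 7, 8, 9, 0, 11, 12, 13, 14, 15, 16, 17, 18, 19, 10]"

text \<open>
  The half-turn of the solid about the midpoint of the edge between \<open>Outer 0\<close> and \<open>Inner 0\<close>. The
  rotation preserves the outer and the inner vertices; this symmetry connects the two orbits.
\<close>

definition dodecahedron_flip :: "nat list" where
  "dodecahedron_flip =
    [10, 18, 8, 7, 17, 15, 13, 3, 2, 12, 0, 16, 9, 6, 19, 5, 11, 4, 1, 14]"

definition dodecahedron_words :: "nat list list list" where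
  "dodecahedron_words =
    [replicate i dodecahedron_rotation @ w. w \<leftarrow> [[], [dodecahedron_flip]], i \<leftarrow> [0..<10]]"

lemma petersen_edgesI:
  assumes "i < n" "j < n"
  shows "(i + 1) mod n = j \<or> (j + 1) mod n = i \<Longrightarrow> {Outer i, Outer j} \<in> petersen_edges n k"
    "i = j \<Longrightarrow> {Outer i, Inner j} \<in> petersen_edges n k"
    "i = j \<Longrightarrow> {Inner i, Outer j} \<in> petersen_edges n k"
    "(i + k) mod n = j \<or> (j + k) mod n = i \<Longrightarrow> {Inner i, Inner j} \<in> petersen_edges n k"
proof -
  have edges: "{Outer l, Outer ((l + 1) mod n)} \<in> petersen_edges n k"
    "{Outer l, Inner l} \<in> petersen_edges n k"
    "{Inner l, Inner ((l + k) mod n)} \<in> petersen_edges n k" if "l < n" for l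
    using that unfolding petersen_edges_def by blast+
  show "(i + 1) mod n = j \<or> (j + 1) mod n = i \<Longrightarrow> {Outer i, Outer j} \<in> petersen_edges n k"
    using edges(1)[OF assms(1)] edges(1)[OF assms(2)] by (metis insert_commute)
  show "(i + k) mod n = j \<or> (j + k) mod n = i \<Longrightarrow> {Inner i, Inner j} \<in> petersen_edges n k"
    using edges(3)[OF assms(1)] edges(3)[OF assms(2)] by (metis insert_commute)
  show "i = j \<Longrightarrow> {Outer i, Inner j} \<in> petersen_edges n k"
    using edges(2)[OF assms(1)] by simp
  show "i = j \<Longrightarrow> {Inner i, Outer j} \<in> petersen_edges n k"
    using edges(2)[OF assms(1)] by (simp add: insert_commute)
qed

lemma dodecahedron_embedding:
  "embedding dodecahedron_adj dodecahedron_vertices dodecahedron_edges dodecahedron_vertex"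
proof -
  have "bij_betw dodecahedron_vertex {..<20} dodecahedron_vertices"
    unfolding bij_betw_def
  proof
    show "inj_on dodecahedron_vertex {..<20}"
      by (auto simp: inj_on_def dodecahedron_vertex_def split: if_splits)
    have "{..<20} = {..<10} \<union> (\<lambda>i. i + 10) ` {..<10 :: nat}"
      by (simp add: lessThan_atLeast0 image_add_atLeastLessThan' ivl_disj_un)
    then have "dodecahedron_vertex ` {..<20}
        = dodecahedron_vertex ` {..<10} \<union> (\<lambda>i. dodecahedron_vertex (i + 10)) ` {..<10}"
      by (simp only: image_Un image_image)
    also have "\<dots> = Outer ` {..<10} \<union> Inner ` {..<10}"
      by (intro arg_cong2[where f = "(\<union>)"] image_cong) (simp_all add: dodecahedron_vertex_def)
    finally show "dodecahedron_vertex ` {..<20} = dodecahedron_vertices"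
      by (simp add: dodecahedron_vertices_def petersen_vertices_def)
  qed
  moreover have "\<forall>u\<in>set [0..<20]. \<forall>v\<in>set (dodecahedron_adj ! u). v < 20 \<and>
      {dodecahedron_vertex u, dodecahedron_vertex v} \<in> dodecahedron_edges"
    unfolding dodecahedron_edges_def dodecahedron_adj_def
    by (simp add: upt_rec dodecahedron_vertex_def petersen_edgesI)
  ultimately show ?thesis
    by (simp add: embedding_def length_dodecahedron_adj)
qed

lemma dodecahedron_automorphisms:
  "automorphism dodecahedron_adj dodecahedron_rotation"
  "automorphism dodecahedron_adj dodecahedron_flip"
  by code_simp+

lemma dodecahedron_transitive:
  "set [0..<20] \<subseteq> set (map (\<lambda>w. foldr (!) w 0) dodecahedron_words)"
  by code_simp

lemma finite_dodecahedron: "finite dodecahedron_edges"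
  by (simp add: dodecahedron_edges_def petersen_edges_def)

text \<open>
  One polynomial for each of the distances 1 to 5: the graph is distance transitive. The lists are the
  spheres around the vertex 0.
\<close>

lemma dodecahedron_union_polys:
  "\<forall>t\<in>set [1, 9, 10]. union_poly (path_edges dodecahedron_adj 5 [] 0 t)
    = [:0, 1, 0, 0, 2, -2, 0, 0, -1, 1:]"
  "\<forall>t\<in>set [2, 8, 11, 12, 18, 19]. union_poly (path_edges dodecahedron_adj 5 [] 0 t)
    = [:0, 0, 1, 1, 0, 1, -2, 0, -2, 2:]"
  "\<forall>t\<in>set [3, 7, 13, 14, 16, 17]. union_poly (path_edges dodecahedron_adj 5 [] 0 t)
    = [:0, 0, 0, 1, 2, 2, -2, -2, -3, 1, -1, 4, 0, 1, -3, 1:]"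
  "\<forall>t\<in>set [4, 6, 15]. union_poly (path_edges dodecahedron_adj 5 [] 0 t)
    = [:0, 0, 0, 0, 2, 4, 0, -6, -1, -4, 3, 6, -2, 2, -5, 2:]"
  "union_poly (path_edges dodecahedron_adj 5 [] 0 5)
    = [:0, 0, 0, 0, 0, 6, 0, 0, 0, -6, -9, 0, 0, 6, 12, 2, 0, -6, -9, 0, 0, 6, 0, 0, -1:]"
  by code_simp+

lemma dodecahedron_sum:
  "(\<Sum>t<20. union_poly (path_edges dodecahedron_adj 5 [] 0 t))
    = [:1, 3, 6, 12, 24, 30, -24, -30, -36, 3, -6, 42, -6, 18, -21, 14, 0, -6, -9, 0, 0, 6, 0, 0, -1:]"
proof -
  have "{..<20} = set [0, 1, 9, 10, 2, 8, 11, 12, 18, 19, 3, 7, 13, 14, 16, 17, 4, 6, 15, 5 :: nat]"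
    unfolding lessThan_atLeast0 set_upt[symmetric] by code_simp
  moreover have "union_poly (path_edges dodecahedron_adj 5 [] 0 0) = 1"
    by code_simp
  ultimately show ?thesis
    using dodecahedron_union_polys by (simp add: one_pCons)
qed

section \<open>The icosahedron\<close>

text \<open>
  The vertices 0 and 11 are opposite poles; 1 to 5 and 6 to 10 are the cycles of their neighbours.
\<close>

definition icosahedron_adj :: "nat list list" where
  "icosahedron_adj =
    [[1, 2, 3, 4, 5],
     [0, 2, 5, 6, 10], [0, 1, 3, 6, 7], [0, 2, 4, 7, 8], [0, 3, 5, 8, 9], [0, 1, 4, 9, 10],
     [1, 2, 7, 10, 11], [2, 3, 6, 8, 11], [3, 4, 7, 9, 11], [4, 5, 8, 10, 11], [1, 5, 6, 9, 11],
     [6, 7, 8, 9, 10]]"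

lemma length_icosahedron_adj: "length icosahedron_adj = 12"
  by (simp add: icosahedron_adj_def)

definition icosahedron_points :: "(real \<times> real \<times> real) list" where
  "icosahedron_points = (let g = golden_ratio in
    [(0, 1, g),
     (0, -1, g), (-g, 0, 1), (-1, g, 0), (1, g, 0), (g, 0, 1),
     (-1, -g, 0), (-g, 0, -1), (0, 1, -g), (g, 0, -1), (1, -g, 0),
     (0, -1, -g)])"

definition icosahedron_rotation :: "nat list" where
  "icosahedron_rotation = [0, 2, 3, 4, 5, 1, 7, 8, 9, 10, 6, 11]"

text \<open>
  The reflection that exchanges the adjacent vertices 0 and 1; it fixes 2, 5, 7 and 9.
\<close>

definition icosahedron_flip :: "nat list" where
  "icosahedron_flip = [1, 0, 2, 6, 10, 5, 3, 7, 11, 9, 4, 8]"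

text \<open>
  The flip carries 0 to 1 on the upper ring, two rotations and a flip then lead to 6 on the lower ring,
  and two more rotations and a flip to the opposite pole 11. The power of the rotation in front runs
  through the rings.
\<close>

definition icosahedron_words :: "nat list list list" where
  "icosahedron_words = (let r = icosahedron_rotation; s = icosahedron_flip in
    [replicate i r @ w. w \<leftarrow> [[], [s], [s, r, r, s], [s, r, r, s, r, r, s]], i \<leftarrow> [0..<5]])"

lemma golden_ratio_gt_1: "golden_ratio > 1"
  by (simp add: golden_ratio_def)

lemma golden_ratio_square: "golden_ratio * golden_ratio = golden_ratio + 1"
  by (simp add: golden_ratio_def field_simps)

lemma icosahedron_edgeI:
  assumes "(a, b, c) \<in> icosahedron_vertices" "(a', b', c') \<in> icosahedron_vertices"
    "(a - a')\<^sup>2 + (b - b')\<^sup>2 + (c - c')\<^sup>2 = 4"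
  shows "{(a, b, c), (a', b', c')} \<in> icosahedron_edges"
proof -
  have "dist (a, b, c) (a', b', c') = 2"
    using assms(3) by (simp add: dist_prod_def dist_real_def add.assoc)
  then show ?thesis
    using assms(1,2) unfolding icosahedron_edges_def by blast
qed

lemma set_icosahedron_points: "set icosahedron_points = icosahedron_vertices"
  by (auto simp: icosahedron_points_def icosahedron_vertices_def Let_def)

lemma icosahedron_embedding:
  "embedding icosahedron_adj icosahedron_vertices icosahedron_edges ((!) icosahedron_points)"
proof -
  have "distinct icosahedron_points"
    using golden_ratio_gt_1 by (simp add: icosahedron_points_def Let_def)
  then have "bij_betw ((!) icosahedron_points) {..<12} icosahedron_vertices"
    by (intro bij_betw_nth) (simp_all add: set_icosahedron_points, simp add: icosahedron_points_def Let_def)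
  moreover have "\<forall>u\<in>set [0..<12]. \<forall>v\<in>set (icosahedron_adj ! u). v < 12 \<and>
     {icosahedron_points ! u, icosahedron_points ! v} \<in> icosahedron_edges"
    unfolding icosahedron_adj_def icosahedron_points_def Let_def
    apply (simp add: upt_rec)
    apply (intro conjI icosahedron_edgeI)
    apply (simp_all add: icosahedron_vertices_def power2_eq_square algebra_simps golden_ratio_square)
    done
  ultimately show ?thesis
    by (simp add: embedding_def length_icosahedron_adj)
qed

lemma icosahedron_automorphisms:
  "automorphism icosahedron_adj icosahedron_rotation"
  "automorphism icosahedron_adj icosahedron_flip"
  by code_simp+

lemma icosahedron_transitive:
  "set [0..<12] \<subseteq> set (map (\<lambda>w. foldr (!) w 0) icosahedron_words)"
  by code_simp

lemma finite_icosahedron: "finite icosahedron_edges"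
proof -
  have "icosahedron_edges \<subseteq> (\<lambda>(u, v). {u, v}) ` (icosahedron_vertices \<times> icosahedron_vertices)"
    by (auto simp: icosahedron_edges_def)
  then show ?thesis
    by (rule finite_subset) (simp add: icosahedron_vertices_def)
qed

text \<open>
  Again the polynomial depends only on the distance, here 1, 2 or 3, of the target from the vertex 0.
\<close>

lemma icosahedron_union_poly_adjacent:
  "\<forall>t\<in>set [1, 2, 3, 4, 5]. union_poly (path_edges icosahedron_adj 3 [] 0 t)
    = [:0, 1, 2, 2, -9, 1, 4, 8, -12, 4:]"
  by code_simp+

lemma icosahedron_union_poly_distance_two:
  "\<forall>t\<in>set [6, 7, 8, 9, 10]. union_poly (path_edges icosahedron_adj 3 [] 0 t)
    = [:0, 0, 2, 8, -9, -14, 3, 28, -2, -28, 3, 20, -12, 2:]"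
  by code_simp+

lemma icosahedron_union_poly_opposite:
  "union_poly (path_edges icosahedron_adj 3 [] 0 11)
    = [:0, 0, 0, 10, 0, -10, -35, 10, 60, 40, -75, -90, 55, 110, -35, -88, 35, 40, -35, 10, -1:]"
  by code_simp+

lemma icosahedron_sum:
  "(\<Sum>t<12. union_poly (path_edges icosahedron_adj 3 [] 0 t))
    = [:1, 5, 20, 60, -90, -75, 0, 190, -10, -80, -60, 10, -5, 120, -35, -88, 35, 40, -35, 10, -1:]"
proof -
  have "{..<12} = set [0, 1, 2, 3, 4, 5, 6, 7, 8, 9, 10, 11 :: nat]"
    unfolding lessThan_atLeast0 set_upt[symmetric] by code_simp
  moreover have "union_poly (path_edges icosahedron_adj 3 [] 0 0) = 1"
    by code_simp
  ultimately show ?thesis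
    using icosahedron_union_poly_adjacent icosahedron_union_poly_distance_two
      icosahedron_union_poly_opposite
    by (simp add: one_pCons)
qed

section \<open>The two lower bounds\<close>

theorem theorem5:
  fixes p :: real
  assumes "0 < p" and "p < 1"
  shows "(expected_cluster_size dodecahedron_vertices dodecahedron_edges p \<ge>
      1 + 3 * p + 6 * p ^ 2 + 12 * p ^ 3 + 24 * p ^ 4 + 30 * p ^ 5 - 24 * p ^ 6 - 30 * p ^ 7
      - 36 * p ^ 8 + 3 * p ^ 9 - 6 * p ^ 10 + 42 * p ^ 11 - 6 * p ^ 12 + 18 * p ^ 13
      - 21 * p ^ 14 + 14 * p ^ 15 - 6 * p ^ 17 - 9 * p ^ 18 + 6 * p ^ 21 - p ^ 24)
    \<and> (expected_cluster_size icosahedron_vertices icosahedron_edges p \<ge>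
      1 + 5 * p + 20 * p ^ 2 + 60 * p ^ 3 - 90 * p ^ 4 - 75 * p ^ 5 + 190 * p ^ 7 - 10 * p ^ 8
      - 80 * p ^ 9 - 60 * p ^ 10 + 10 * p ^ 11 - 5 * p ^ 12 + 120 * p ^ 13 - 35 * p ^ 14
      - 88 * p ^ 15 + 35 * p ^ 16 + 40 * p ^ 17 - 35 * p ^ 18 + 10 * p ^ 19 - p ^ 20)"
proof
  have "\<forall>w\<in>set dodecahedron_words. \<forall>g\<in>set w. automorphism dodecahedron_adj g"
    using dodecahedron_automorphisms by (auto simp: dodecahedron_words_def)
  then have "(\<Sum>t<20. poly (union_poly (path_edges dodecahedron_adj 5 [] 0 t)) p)
      \<le> expected_cluster_size dodecahedron_vertices dodecahedron_edges p"
    using expected_cluster_size_ge[OF dodecahedron_embedding finite_dodecahedron, of p dodecahedron_words 5]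
      dodecahedron_transitive assms
    by (simp add: length_dodecahedron_adj lessThan_atLeast0 dodecahedron_adj_def[THEN arg_cong, of "\<lambda>x. x = []"])
  then show "expected_cluster_size dodecahedron_vertices dodecahedron_edges p \<ge>
      1 + 3 * p + 6 * p ^ 2 + 12 * p ^ 3 + 24 * p ^ 4 + 30 * p ^ 5 - 24 * p ^ 6 - 30 * p ^ 7
      - 36 * p ^ 8 + 3 * p ^ 9 - 6 * p ^ 10 + 42 * p ^ 11 - 6 * p ^ 12 + 18 * p ^ 13
      - 21 * p ^ 14 + 14 * p ^ 15 - 6 * p ^ 17 - 9 * p ^ 18 + 6 * p ^ 21 - p ^ 24"
    unfolding poly_sum[symmetric] dodecahedron_sum
    by (simp add: algebra_simps eval_nat_numeral)
next
  have "\<forall>w\<in>set icosahedron_words. \<forall>g\<in>set w. automorphism icosahedron_adj g"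
    using icosahedron_automorphisms by (auto simp: icosahedron_words_def Let_def)
  then have "(\<Sum>t<12. poly (union_poly (path_edges icosahedron_adj 3 [] 0 t)) p)
      \<le> expected_cluster_size icosahedron_vertices icosahedron_edges p"
    using expected_cluster_size_ge[OF icosahedron_embedding finite_icosahedron, of p icosahedron_words 3]
      icosahedron_transitive assms
    by (simp add: length_icosahedron_adj lessThan_atLeast0 icosahedron_adj_def[THEN arg_cong, of "\<lambda>x. x = []"])
  then show "expected_cluster_size icosahedron_vertices icosahedron_edges p \<ge>
      1 + 5 * p + 20 * p ^ 2 + 60 * p ^ 3 - 90 * p ^ 4 - 75 * p ^ 5 + 190 * p ^ 7 - 10 * p ^ 8
      - 80 * p ^ 9 - 60 * p ^ 10 + 10 * p ^ 11 - 5 * p ^ 12 + 120 * p ^ 13 - 35 * p ^ 14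
      - 88 * p ^ 15 + 35 * p ^ 16 + 40 * p ^ 17 - 35 * p ^ 18 + 10 * p ^ 19 - p ^ 20"
    unfolding poly_sum[symmetric] icosahedron_sum
    by (simp add: algebra_simps eval_nat_numeral)
qed

end
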